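(* Let $G$ be a countably infinite discrete group and $H$ a subgroup of $G$ with $[G:H]<+\infty$. Let $(X,H,\alpha)$ be a topological dynamical system and $(X_H^G,G,\alpha^{H\backslash G})$ its co-induced system. Then for every $k\in\mathbb{N}$, $$IN_k(X_H^G,G)\subseteq\prod_{\theta\in H\backslash G}IN_k(X,H),$$ that is, if $(f_1,\dots,f_k)\in IN_k(X_H^G,G)$, then $(f_1(\theta),\dots,f_k(\theta))\in IN_k(X,H)$ for every $\theta\in H\backslash G$.
   Context: A topological dynamical system (t.d.s.) $(X,G,\alpha)$ consists of a compact metric space $X$, a group $G$, and an action $(g,x)\mapsto\alpha_g(x)$ of $G$ on $X$ by homeomorphisms. $\mathbb{N}=\{1,2,\dots\}$ and $[k]=\{1,\dots,k\}$. Co-induced system: let $H\leq G$, let $H\backslash G$ be the set of right cosets $Hg$, and fix a section $s:H\backslash G\to G$ (so $s(\theta)\in\theta$) with $s(H)=e$. Given a t.d.s. $(X,H,\alpha)$, put $X_H^G=\prod_{\theta\in H\backslash G}X$ (functions $f:H\backslash G\to X$, product topology), with $G$-action $$\alpha^{H\backslash G}_{g_0}(f)(Hg)=\alpha_{s(Hg)g_0s(Hgg_0)^{-1}}\big(f(Hgg_0)\big).$$ Up to conjugacy of $G$-systems this does not depend on the section $s$. A set $I\subseteq G$ is an independence set for a tuple $(A_1,\dots,A_k)$ of subsets of a $G$-system $X$ if $\bigcap_{g\in F}\alpha_{g^{-1}}(A_{\omega(g)})\neq\emptyset$ for every non-empty finite $F\subseteq I$ and every function $\omega:F\to[k]$.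 A tuple $(x_1,\dots,x_k)\in X^k$ is an $IN$-tuple if for every product neighborhood $U_1\times\dots\times U_k$ of it the tuple $(U_1,\dots,U_k)$ has arbitrarily large finite independence sets. $IN_k(X,G)$ denotes the set of $IN$-tuples of length $k$. *)

theory Defs
  imports "HOL-Analysis.Analysis" "HOL-Algebra.Group_Action"
begin

text \<open>
  Spaces are abstract topologies, so that \<open>X\<close> and its co-induced product are systems in the same
  sense. Following the library's \<open>group_action\<close>, each \<open>\<alpha> g\<close> is extensional on the space.
\<close>

definition tds :: "('g, 'm) monoid_scheme \<Rightarrow> 'x topology \<Rightarrow> ('g \<Rightarrow> 'x \<Rightarrow> 'x) \<Rightarrow> bool" where
  "tds G T \<alpha> \<longleftrightarrow>
     group G \<and> compact_space T \<and> metrizable_space T \<and>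
     group_action G (topspace T) \<alpha> \<and>
     (\<forall>g\<in>carrier G. homeomorphic_map T T (\<alpha> g))"

definition coset_section :: "('g, 'm) monoid_scheme \<Rightarrow> 'g set \<Rightarrow> ('g set \<Rightarrow> 'g) \<Rightarrow> bool" where
  "coset_section G H s \<longleftrightarrow> (\<forall>\<theta>\<in>rcosets\<^bsub>G\<^esub> H. s \<theta> \<in> \<theta>) \<and> s H = \<one>\<^bsub>G\<^esub>"

definition coind_space ::
    "('g, 'm) monoid_scheme \<Rightarrow> 'g set \<Rightarrow> 'x topology \<Rightarrow> ('g set \<Rightarrow> 'x) topology" where
  "coind_space G H T = product_topology (\<lambda>_. T) (rcosets\<^bsub>G\<^esub> H)"

text \<open>For \<open>\<theta> = Hg\<close>, the coset \<open>Hgg\<^sub>0\<close> is \<open>\<theta> #> g\<^sub>0\<close>.\<close>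

definition coind_action ::
    "('g, 'm) monoid_scheme \<Rightarrow> 'g set \<Rightarrow> ('g set \<Rightarrow> 'g) \<Rightarrow> 'x topology \<Rightarrow> ('g \<Rightarrow> 'x \<Rightarrow> 'x)
      \<Rightarrow> 'g \<Rightarrow> ('g set \<Rightarrow> 'x) \<Rightarrow> ('g set \<Rightarrow> 'x)" where
  "coind_action G H s T \<alpha> g\<^sub>0 =
     (\<lambda>f\<in>topspace (coind_space G H T). \<lambda>\<theta>\<in>rcosets\<^bsub>G\<^esub> H.
        \<alpha> (s \<theta> \<otimes>\<^bsub>G\<^esub> g\<^sub>0 \<otimes>\<^bsub>G\<^esub> inv\<^bsub>G\<^esub> (s (\<theta> #>\<^bsub>G\<^esub> g\<^sub>0))) (f (\<theta> #>\<^bsub>G\<^esub> g\<^sub>0)))"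

text \<open>A \<open>k\<close>-tuple is a function on \<open>{1..k}\<close>.\<close>

definition independence_set ::
    "('g, 'm) monoid_scheme \<Rightarrow> ('g \<Rightarrow> 'x \<Rightarrow> 'x) \<Rightarrow> nat \<Rightarrow> (nat \<Rightarrow> 'x set) \<Rightarrow> 'g set \<Rightarrow> bool" where
  "independence_set G \<alpha> k A I \<longleftrightarrow>
     I \<subseteq> carrier G \<and>
     (\<forall>F \<omega>. F \<subseteq> I \<and> finite F \<and> F \<noteq> {} \<and> \<omega> \<in> F \<rightarrow> {1..k} \<longrightarrow>
        (\<Inter>g\<in>F. \<alpha> (inv\<^bsub>G\<^esub> g) ` A (\<omega> g)) \<noteq> {})"

definition IN_tuples ::
    "('g, 'm) monoid_scheme \<Rightarrow> 'x topology \<Rightarrow> ('g \<Rightarrow> 'x \<Rightarrow> 'x) \<Rightarrow> nat \<Rightarrow> (nat \<Rightarrow> 'x) set" where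
  "IN_tuples G T \<alpha> k =
     {x \<in> {1..k} \<rightarrow>\<^sub>E topspace T.
        \<forall>U. (\<forall>i\<in>{1..k}. U i \<subseteq> topspace T \<and> x i \<in> T interior_of (U i)) \<longrightarrow>
            (\<forall>n::nat. \<exists>I. finite I \<and> n \<le> card I \<and> independence_set G \<alpha> k U I)}"

end

theory Submission
  imports Defs
begin

text \<open>
  Fix \<open>\<theta>\<close> and pull neighbourhoods \<open>U\<^sub>i\<close> of \<open>f\<^sub>i(\<theta>)\<close> back along the evaluation at \<open>\<theta>\<close>. A large finite
  independence set \<open>I\<close> of the pulled-back tuple contains, by the pigeonhole principle on the finitely
  many cosets, a large subset on which \<open>\<theta>g\<close> is a constant coset \<open>\<theta>'\<close>. The injection
  \<open>g \<mapsto> s(\<theta>) g s(\<theta>')\<^sup>-\<^sup>1\<close> maps this subset into \<open>H\<close>, and evaluating a witness of independence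
  in the co-induced system at \<open>\<theta>'\<close> yields a witness of independence in \<open>X\<close>.
\<close>

lemma (in group) rcoset_mult_in_rcosets:
  assumes "subgroup H G" and "\<theta> \<in> rcosets H" and "g \<in> carrier G"
  shows "\<theta> #> g \<in> rcosets H"
proof -
  obtain a where a: "a \<in> carrier G" "\<theta> = H #> a"
    using assms(2) by (auto simp: RCOSETS_def)
  have "\<theta> #> g = H #> (a \<otimes> g)"
    using a assms by (simp add: coset_mult_assoc subgroup.subset)
  then show ?thesis
    using a assms by (auto simp: RCOSETS_def)
qed

text \<open>Both \<open>a \<otimes> g\<close> and \<open>b\<close> represent the coset
  \<open>\<theta> #> g\<close>, so they differ by a left factor from \<open>H\<close>. This places
  the elements through which the co-induced action applies \<open>\<alpha>\<close> inside
  \<open>H\<close>.\<close>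

lemma (in group) rcoset_transition_in_subgroup:
  assumes "subgroup H G" and "\<theta> \<in> rcosets H" and "g \<in> carrier G"
    and "a \<in> \<theta>" and "b \<in> \<theta> #> g"
  shows "a \<otimes> g \<otimes> inv b \<in> H"
proof -
  interpret H: subgroup H G by fact
  obtain c where c: "c \<in> carrier G" "\<theta> = H #> c"
    using assms(2) by (auto simp: RCOSETS_def)
  obtain h where h: "h \<in> H" "a = h \<otimes> c"
    using assms(4) c by (auto simp: r_coset_def)
  obtain h' where h': "h' \<in> H" "b = h' \<otimes> c \<otimes> g"
    using assms(5) c by (auto simp: r_coset_def)
  have mem: "h \<in> carrier G" "h' \<in> carrier G"
    using h h' H.mem_carrier by auto
  have "inv b = inv (c \<otimes> g) \<otimes> inv h'"
    using mem c assms(3) h' by (simp add: m_assoc inv_mult_group)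
  moreover have "a \<otimes> g = h \<otimes> (c \<otimes> g)"
    using mem c assms(3) h by (simp add: m_assoc)
  \<comment> \<open>The regrouping isolates the common representative \<open>c \<otimes> g\<close>
    of \<open>\<theta> #> g\<close>, which then cancels.\<close>
  ultimately have "a \<otimes> g \<otimes> inv b = h \<otimes> ((c \<otimes> g) \<otimes> inv (c \<otimes> g)) \<otimes> inv h'"
    using mem c assms(3) by (simp only: m_assoc m_closed inv_closed)
  also have "\<dots> = h \<otimes> inv h'"
    using mem c assms(3) by (simp add: r_inv)
  finally show ?thesis
    using h h' by simp
qed

text \<open>At the coset \<open>\<theta> #> g\<close>, translating by \<open>inv g\<close> leads
  back to \<open>\<theta>\<close>, so only the coordinate \<open>f \<theta>\<close> enters. The
  acting element is written as an inverse to match the shape of the sets in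
  \<open>independence_set\<close>.\<close>

lemma (in group) coind_action_inv_apply:
  assumes "subgroup H G" and "coset_section G H s"
    and "\<theta> \<in> rcosets H" and "g \<in> carrier G" and "f \<in> topspace (coind_space G H T)"
  shows "coind_action G H s T \<alpha> (inv g) f (\<theta> #> g) = \<alpha> (inv (s \<theta> \<otimes> g \<otimes> inv (s (\<theta> #> g)))) (f \<theta>)"
proof -
  have \<theta>g: "\<theta> #> g \<in> rcosets H"
    using assms by (simp add: rcoset_mult_in_rcosets)
  have carr: "\<theta> \<subseteq> carrier G" "\<theta> #> g \<subseteq> carrier G"
    using assms(1,3) \<theta>g by (auto dest: subgroup.rcosets_carrier[OF _ is_group])
  then have s: "s \<theta> \<in> carrier G" "s (\<theta> #> g) \<in> carrier G"
    using assms(2,3) \<theta>g by (auto simp: coset_section_def)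
  have \<theta>_eq: "\<theta> #> g #> inv g = \<theta>"
    using carr assms(4) by (simp add: coset_mult_assoc coset_mult_one)
  show ?thesis
    using s assms(4,5) \<theta>g \<theta>_eq by (simp add: coind_action_def inv_mult_group m_assoc)
qed

text \<open>Since \<open>\<theta> #> g\<close> is the same coset \<open>\<theta>'\<close> for all
  \<open>g\<close> in \<open>I\<close>, a single coordinate of a common point in the co-induced
  system serves every constraint at once.\<close>

lemma (in group) independence_set_of_coind:
  assumes H: "subgroup H G" and s: "coset_section G H s"
    and \<theta>: "\<theta> \<in> rcosets H"
    and ind: "independence_set G (coind_action G H s T \<alpha>) k
                (\<lambda>i. {f \<in> topspace (coind_space G H T). f \<theta> \<in> U i}) I"
    and const: "\<And>g. g \<in> I \<Longrightarrow> \<theta> #> g = \<theta>'"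
  shows "independence_set (G\<lparr>carrier := H\<rparr>) \<alpha> k U ((\<lambda>g. s \<theta> \<otimes> g \<otimes> inv (s \<theta>')) ` I)"
proof -
  define \<phi> where "\<phi> = (\<lambda>g. s \<theta> \<otimes> g \<otimes> inv (s \<theta>'))"
  define V where "V = (\<lambda>i. {f \<in> topspace (coind_space G H T). f \<theta> \<in> U i})"
  have I: "I \<subseteq> carrier G"
    using ind by (simp add: independence_set_def)
  have \<phi>H: "\<phi> g \<in> H" if "g \<in> I" for g
  proof -
    have g: "g \<in> carrier G" using that I by auto
    have "\<theta>' \<in> rcosets H"
      using rcoset_mult_in_rcosets[OF H \<theta> g] const[OF that] by simp
    then show ?thesis
      unfolding \<phi>_def using s \<theta> const[OF that]
      by (intro rcoset_transition_in_subgroup[OF H \<theta> g]) (auto simp: coset_section_def)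
  qed
  have "(\<Inter>h\<in>F. \<alpha> (inv\<^bsub>G\<lparr>carrier := H\<rparr>\<^esub> h) ` U (\<omega> h)) \<noteq> {}"
    if F: "F \<subseteq> \<phi> ` I" "finite F" "F \<noteq> {}" and \<omega>: "\<omega> \<in> F \<rightarrow> {1..k}" for F \<omega>
  proof -
    \<comment> \<open>Lifting \<open>F\<close> along \<open>\<phi>\<close> and colouring by
      \<open>\<omega> \<circ> \<phi>\<close> needs no injectivity: elements with the same image
      receive the same colour.\<close>
    obtain F' where F': "F' \<subseteq> I" "finite F'" "F = \<phi> ` F'"
      using finite_subset_image[OF F(2,1)] by blast
    have "F' \<noteq> {}" and "\<omega> \<circ> \<phi> \<in> F' \<rightarrow> {1..k}"
      using F F' \<omega> by auto
    then have "(\<Inter>g\<in>F'. coind_action G H s T \<alpha> (inv g) ` V ((\<omega> \<circ> \<phi>) g)) \<noteq> {}"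
      using ind F' unfolding independence_set_def V_def by blast
    then obtain f where f: "\<And>g. g \<in> F' \<Longrightarrow> f \<in> coind_action G H s T \<alpha> (inv g) ` V (\<omega> (\<phi> g))"
      by auto
    have "f \<theta>' \<in> \<alpha> (inv\<^bsub>G\<lparr>carrier := H\<rparr>\<^esub> h) ` U (\<omega> h)" if "h \<in> F" for h
    proof -
      obtain g where g: "g \<in> F'" "h = \<phi> g" using \<open>h \<in> F\<close> F' by auto
      obtain f' where f': "f' \<in> V (\<omega> h)" "f = coind_action G H s T \<alpha> (inv g) f'"
        using f[OF g(1)] g(2) by auto
      have gI: "g \<in> I" "g \<in> carrier G" using g F' I by auto
      have "f \<theta>' = \<alpha> (inv h) (f' \<theta>)"
        using coind_action_inv_apply[OF H s \<theta> gI(2), of f' T \<alpha>] f' g const[OF gI(1)]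
        by (simp add: V_def \<phi>_def)
      \<comment> \<open>Independence in the \<open>H\<close>-system uses the inverse of the
        restricted group, which agrees with that of \<open>G\<close> on \<open>H\<close>.\<close>
      moreover have "inv\<^bsub>G\<lparr>carrier := H\<rparr>\<^esub> h = inv h"
        using m_inv_consistent[OF H] \<phi>H[OF gI(1)] g by simp
      ultimately show ?thesis using f' by (auto simp: V_def)
    qed
    then show ?thesis by blast
  qed
  then show ?thesis
    using \<phi>H unfolding independence_set_def \<phi>_def[symmetric] by auto
qed

lemma independence_set_subset:
  assumes "independence_set G \<alpha> k A I" and "J \<subseteq> I"
  shows "independence_set G \<alpha> k A J"
  using assms unfolding independence_set_def by (meson subset_trans)

text \<open>Evaluation at \<open>\<theta>\<close> is continuous, so the preimage of the interior of
  \<open>W\<close> is an open set around \<open>f\<close> inside the preimage of \<open>W\<close>;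
  the set \<open>W\<close> itself may fail to be open.\<close>

lemma evaluation_preimage_interior_of:
  assumes "\<theta> \<in> rcosets\<^bsub>G\<^esub> H" and "f \<in> topspace (coind_space G H T)" and "f \<theta> \<in> T interior_of W"
  shows "f \<in> coind_space G H T interior_of {f \<in> topspace (coind_space G H T). f \<theta> \<in> W}"
proof -
  have "continuous_map (coind_space G H T) T (\<lambda>f. f \<theta>)"
    unfolding coind_space_def using assms(1) by (rule continuous_map_product_projection)
  then have "openin (coind_space G H T) {f \<in> topspace (coind_space G H T). f \<theta> \<in> T interior_of W}"
    by (rule openin_continuous_map_preimage) simp
  moreover have "T interior_of W \<subseteq> W" by (rule interior_of_subset)
  ultimately show ?thesis
    using assms(2,3) unfolding interior_of_def[of "coind_space G H T"] by blast
qed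

theorem lemma3p2:
  fixes G :: "('g, 'm) monoid_scheme"
    and H :: "'g set"
    and s :: "'g set \<Rightarrow> 'g"
    and T :: "'x topology"
    and \<alpha> :: "'g \<Rightarrow> 'x \<Rightarrow> 'x"
    and k :: nat
  assumes "group G" and "countable (carrier G)" and "infinite (carrier G)"
    and "subgroup H G" and "finite (rcosets\<^bsub>G\<^esub> H)"
    and "coset_section G H s"
    and "tds (G\<lparr>carrier := H\<rparr>) T \<alpha>"
    and "k \<ge> 1"
  shows "\<forall>f \<in> IN_tuples G (coind_space G H T) (coind_action G H s T \<alpha>) k.
           \<forall>\<theta> \<in> rcosets\<^bsub>G\<^esub> H.
             (\<lambda>i\<in>{1..k}. f i \<theta>) \<in> IN_tuples (G\<lparr>carrier := H\<rparr>) T \<alpha> k"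
proof (intro ballI)
  fix f \<theta>
  assume f: "f \<in> IN_tuples G (coind_space G H T) (coind_action G H s T \<alpha>) k"
    and \<theta>: "\<theta> \<in> rcosets\<^bsub>G\<^esub> H"
  interpret group G by fact
  have fi: "f i \<in> topspace (coind_space G H T)" if "i \<in> {1..k}" for i
    using f that by (auto simp: IN_tuples_def)
  then have fi\<theta>: "f i \<theta> \<in> topspace T" if "i \<in> {1..k}" for i
    using \<theta> that by (auto simp: coind_space_def)
  have s: "s \<theta>' \<in> carrier G" if "\<theta>' \<in> rcosets\<^bsub>G\<^esub> H" for \<theta>'
    using assms(4,6) that by (auto simp: coset_section_def dest: subgroup.rcosets_carrier[OF _ is_group])
  have "\<exists>J. finite J \<and> n \<le> card J \<and> independence_set (G\<lparr>carrier := H\<rparr>) \<alpha> k U J"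
    if U: "\<forall>i\<in>{1..k}. U i \<subseteq> topspace T \<and> f i \<theta> \<in> T interior_of (U i)" for U and n :: nat
  proof -
    define V where "V = (\<lambda>i. {f \<in> topspace (coind_space G H T). f \<theta> \<in> U i})"
    have "\<forall>i\<in>{1..k}. V i \<subseteq> topspace (coind_space G H T) \<and> f i \<in> coind_space G H T interior_of (V i)"
      unfolding V_def using U by (auto intro!: evaluation_preimage_interior_of[OF \<theta>] fi)
    then obtain I where I: "finite I" "n * card (rcosets\<^bsub>G\<^esub> H) \<le> card I"
      "independence_set G (coind_action G H s T \<alpha>) k V I"
      using f unfolding IN_tuples_def by blast
    have Isub: "I \<subseteq> carrier G"
      using I(3) by (simp add: independence_set_def)
    have "(\<lambda>g. \<theta> #>\<^bsub>G\<^esub> g) \<in> I \<rightarrow> rcosets\<^bsub>G\<^esub> H"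
      using rcoset_mult_in_rcosets[OF assms(4) \<theta>] Isub by auto
    then obtain \<theta>' where \<theta>': "\<theta>' \<in> rcosets\<^bsub>G\<^esub> H"
      "card I \<le> card ((\<lambda>g. \<theta> #>\<^bsub>G\<^esub> g) -` {\<theta>'} \<inter> I) * card (rcosets\<^bsub>G\<^esub> H)"
      using pigeonhole_card[of "\<lambda>g. \<theta> #>\<^bsub>G\<^esub> g" I "rcosets\<^bsub>G\<^esub> H"] I(1) assms(5) \<theta> by blast
    define I' where "I' = (\<lambda>g. \<theta> #>\<^bsub>G\<^esub> g) -` {\<theta>'} \<inter> I"
    have "card (rcosets\<^bsub>G\<^esub> H) > 0"
      using assms(5) \<theta> by (auto simp: card_gt_0_iff)
    moreover have "n * card (rcosets\<^bsub>G\<^esub> H) \<le> card I' * card (rcosets\<^bsub>G\<^esub> H)"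
      using I(2) \<theta>'(2) unfolding I'_def by linarith
    ultimately have n: "n \<le> card I'"
      by simp
    let ?\<phi> = "\<lambda>g. s \<theta> \<otimes>\<^bsub>G\<^esub> g \<otimes>\<^bsub>G\<^esub> inv\<^bsub>G\<^esub> (s \<theta>')"
    have "independence_set (G\<lparr>carrier := H\<rparr>) \<alpha> k U (?\<phi> ` I')"
      using independence_set_subset[OF I(3), of I'] unfolding V_def
      by (intro independence_set_of_coind[OF assms(4,6) \<theta>]) (auto simp: I'_def)
    \<comment> \<open>Cancelling the fixed outer factors gives injectivity, so the image in
      \<open>H\<close> keeps the cardinality of \<open>I'\<close>.\<close>
    moreover have "inj_on ?\<phi> I'"
      using s[OF \<theta>] s[OF \<theta>'(1)] Isub by (intro inj_onI) (auto simp: I'_def subset_iff)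
    ultimately show ?thesis
      using n I(1) by (intro exI[of _ "?\<phi> ` I'"]) (auto simp: card_image I'_def)
  qed
  then show "(\<lambda>i\<in>{1..k}. f i \<theta>) \<in> IN_tuples (G\<lparr>carrier := H\<rparr>) T \<alpha> k"
    using fi\<theta> unfolding IN_tuples_def by auto
qed

end
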